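(* Let $\mathcal A=(S,E,\ell,s_0,d,(g_i)_{i\in S})$ be a symbolic DLSL system with dwell over a finite input alphabet $\Omega$, and let $T_{\mathcal A}$ be its phase-expanded deterministic realization, viewed as a graph-respecting labeled transducer for $(S,E)$ with visible labeling $\lambda(i,r)=i$. Then $T_{\mathcal A}$ is fiber-linear.
   Context: Visible graph. $S$ is a finite set (visible states), $E\subseteq S\times S$, $\mathrm{Out}(i)=\{j\in S:(i,j)\in E\}$. A labeling $\ell:S\to\Sigma$ into a finite alphabet makes the graph destination-labeled: edge $(i,j)$ carries label $\ell(j)$. The graph is self-looping if $(i,i)\in E$ for all $i$. It is label-deterministic if for every $i\in S$, $a\in\Sigma$ there is at most one $j\in\mathrm{Out}(i)$ with $\ell(j)=a$. Put $\Sigma_i=\{\ell(j):j\in\mathrm{Out}(i)\}$ and, for $a\in\Sigma_i$, let $\delta(i,a)$ be the unique $j\in\mathrm{Out}(i)$ with $\ell(j)=a$. A symbolic DLSL system with dwell is $\mathcal A=(S,E,\ell,s_0,d,(g_i)_{i\in S})$ where $(S,E,\ell)$ is destination-labeled, self-looping and label-deterministic, $s_0\in S$, $d:S\to\mathbb N_{\ge1}$, $i\mapsto d_i$, and $g_i:\Omega\to\Sigma_i$ for each $i$. Phase-expanded realization $T_{\mathcal A}$: control states $Q=\{(i,r):i\in S,\ 0\le r\le d_i-1\}$, initial state $(s_0,d_{s_0}-1)$, transitions $\Delta((i,r),u)=(i,r-1)$ if $r>0$, and $\Delta((i,0),u)=(j,d_j-1)$ with $j=\delta(i,g_i(u))$;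 visible labeling $\lambda(i,r)=i$; the symbol emitted on reading an input is the visible label of the successor state. A graph-respecting labeled transducer for $(S,E)$ is a deterministic transducer $T=(Q,q_0,\Omega,S,\Delta,\lambda)$ with $\Delta:Q\times\Omega\to Q$, $Q$ finite, $\lambda:Q\to S$ surjective, and $\lambda(\Delta(q,u))\in\mathrm{Out}(\lambda(q))$ for all $q\in Q,u\in\Omega$; it emits the visible label of the successor state. A state $q$ is forced-hold if there is $q'\in Q$ with $\lambda(q')=\lambda(q)$ and $\Delta(q,u)=q'$ for every $u\in\Omega$; then $\mathrm{hsucc}(q):=q'$. Otherwise $q$ is a decision state. For $i\in S$ let $\mathrm{Fib}(i)=\lambda^{-1}(i)$; the fiber hold graph $H_i$ has vertex set $\mathrm{Fib}(i)$ and an edge $q\to\mathrm{hsucc}(q)$ for each forced-hold $q\in\mathrm{Fib}(i)$. $T$ is fiber-linear if for every $i\in S$: (1) $H_i$ is a directed simple path on the whole of $\mathrm{Fib}(i)$ ending at a unique terminal vertex $p_i$; equivalently, $p_i$ is the unique decision state in $\mathrm{Fib}(i)$, all other states of $\mathrm{Fib}(i)$ are forced-hold, and iterating $\mathrm{hsucc}$ walks through the fiber in a single linear chain until $p_i$; (2) (reset-on-decision) writing $t_i$ for the initial vertex of the path $H_i$ (so $t_i=p_i$ if $|\mathrm{Fib}(i)|=1$), for every $u\in\Omega$, if $\lambda(\Delta(p_i,u))=j$ then $\Delta(p_i,u)=t_j$.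
   Formalization: Added hypothesis: for every visible state i some input u has δ(i,g_i(u)) ≠ i; without it (i,0) is forced-hold and H_i is a directed cycle (e.g. a single state with only its self-loop), so the claim fails; the condition is also necessary for fiber-linearity. *)

theory Defs
  imports Main "Graph_Theory.Pair_Digraph"
begin

definition Out :: "('s \<times> 's) set \<Rightarrow> 's \<Rightarrow> 's set" where
  "Out E i = {j. (i, j) \<in> E}"

definition self_looping :: "'s set \<Rightarrow> ('s \<times> 's) set \<Rightarrow> bool" where
  "self_looping S E \<longleftrightarrow> (\<forall>i\<in>S. (i, i) \<in> E)"

definition label_deterministic ::
    "'s set \<Rightarrow> ('s \<times> 's) set \<Rightarrow> 'a set \<Rightarrow> ('s \<Rightarrow> 'a) \<Rightarrow> bool" where
  "label_deterministic S E \<Sigma> l \<longleftrightarrow>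
     (\<forall>i\<in>S. \<forall>a\<in>\<Sigma>. \<forall>j\<in>Out E i. \<forall>k\<in>Out E i. l j = a \<and> l k = a \<longrightarrow> j = k)"


text \<open>The finite alphabets \<open>\<Sigma>\<close> (\<open>labels\<close>) and \<open>\<Omega>\<close> (\<open>inputs\<close>) are carried along in the
  record. The functions \<open>lab\<close>, \<open>dwell\<close> and \<open>guard\<close> (the family \<open>g\<close>) are relevant only on
  their carriers \<open>S\<close>, \<open>S\<close> and \<open>S \<times> \<Omega>\<close>.\<close>

record ('s, 'a, 'u) dlsl =
  vstates :: "'s set"
  vedges :: "('s \<times> 's) set"
  labels :: "'a set"
  lab :: "'s \<Rightarrow> 'a"
  inputs :: "'u set"
  vinit :: 's
  dwell :: "'s \<Rightarrow> nat"
  guard :: "'s \<Rightarrow> 'u \<Rightarrow> 'a"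

definition out_labels :: "('s, 'a, 'u, 'z) dlsl_scheme \<Rightarrow> 's \<Rightarrow> 'a set" where
  "out_labels A i = lab A ` Out (vedges A) i"

definition label_succ :: "('s, 'a, 'u, 'z) dlsl_scheme \<Rightarrow> 's \<Rightarrow> 'a \<Rightarrow> 's" where
  "label_succ A i a = (THE j. j \<in> Out (vedges A) i \<and> lab A j = a)"

locale dlsl_system =
  fixes A :: "('s, 'a, 'u, 'z) dlsl_scheme" (structure)
  assumes finite_vstates: "finite (vstates A)"
    and vedges_subset: "vedges A \<subseteq> vstates A \<times> vstates A"
    and finite_labels: "finite (labels A)"
    and lab_in_labels: "i \<in> vstates A \<Longrightarrow> lab A i \<in> labels A"
    and self_loops: "self_looping (vstates A) (vedges A)"
    and label_det: "label_deterministic (vstates A) (vedges A) (labels A) (lab A)"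
    and finite_inputs: "finite (inputs A)"
    and vinit_in: "vinit A \<in> vstates A"
    and dwell_pos: "i \<in> vstates A \<Longrightarrow> 1 \<le> dwell A i"
    and guard_in: "i \<in> vstates A \<Longrightarrow> u \<in> inputs A \<Longrightarrow> guard A i u \<in> out_labels A i"


text \<open>On reading \<open>u\<close> in state \<open>q\<close> the transducer emits \<open>tvis T (tstep T q u)\<close>, the visible
  label of the successor state; hence no separate output function is recorded.\<close>

record ('q, 'u, 's) transducer =
  tstates :: "'q set"
  tinit :: 'q
  tinputs :: "'u set"
  toutputs :: "'s set"
  tstep :: "'q \<Rightarrow> 'u \<Rightarrow> 'q"
  tvis :: "'q \<Rightarrow> 's"

locale graph_respecting_transducer =
  fixes S :: "'s set" and E :: "('s \<times> 's) set" and T :: "('q, 'u, 's, 'z) transducer_scheme"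
  assumes finite_tstates: "finite (tstates T)"
    and tinit_in: "tinit T \<in> tstates T"
    and finite_tinputs: "finite (tinputs T)"
    and toutputs_eq: "toutputs T = S"
    and tstep_closed: "q \<in> tstates T \<Longrightarrow> u \<in> tinputs T \<Longrightarrow> tstep T q u \<in> tstates T"
    and tvis_surj: "tvis T ` tstates T = S"
    and tstep_respects: "q \<in> tstates T \<Longrightarrow> u \<in> tinputs T \<Longrightarrow>
                           tvis T (tstep T q u) \<in> Out E (tvis T q)"

definition hold_target :: "('q, 'u, 's, 'z) transducer_scheme \<Rightarrow> 'q \<Rightarrow> 'q \<Rightarrow> bool" where
  "hold_target T q q' \<longleftrightarrow>
     q' \<in> tstates T \<and> tvis T q' = tvis T q \<and> (\<forall>u\<in>tinputs T. tstep T q u = q')"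

definition forced_hold :: "('q, 'u, 's, 'z) transducer_scheme \<Rightarrow> 'q \<Rightarrow> bool" where
  "forced_hold T q \<longleftrightarrow> (\<exists>q'. hold_target T q q')"

definition hsucc :: "('q, 'u, 's, 'z) transducer_scheme \<Rightarrow> 'q \<Rightarrow> 'q" where
  "hsucc T q = (THE q'. hold_target T q q')"

definition Fib :: "('q, 'u, 's, 'z) transducer_scheme \<Rightarrow> 's \<Rightarrow> 'q set" where
  "Fib T i = {q \<in> tstates T. tvis T q = i}"

definition hold_graph :: "('q, 'u, 's, 'z) transducer_scheme \<Rightarrow> 's \<Rightarrow> 'q pair_pre_digraph" where
  "hold_graph T i =
     \<lparr> pverts = Fib T i, parcs = {(q, hsucc T q) | q. q \<in> Fib T i \<and> forced_hold T q} \<rparr>"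

text \<open>\<open>G\<close> itself is a directed simple path from \<open>s\<close> to \<open>t\<close>: the path uses all vertices and all
  arcs of \<open>G\<close>. In particular loops and chords are excluded, and \<open>s\<close> and \<open>t\<close> are determined
  by \<open>G\<close>; \<open>t\<close> is the only vertex without outgoing arc.\<close>

definition is_simple_path :: "'q pair_pre_digraph \<Rightarrow> 'q \<Rightarrow> 'q \<Rightarrow> bool" where
  "is_simple_path G s t \<longleftrightarrow>
     (\<exists>es. pre_digraph.apath (with_proj G) s es t \<and>
           set (pre_digraph.awalk_verts (with_proj G) s es) = pverts G \<and>
           set es = parcs G)"

text \<open>The functions \<open>t\<close> and \<open>p\<close> give the initial vertex and the terminal vertex (the unique
  decision state) of each fiber path.\<close>

definition fiber_linear :: "'s set \<Rightarrow> ('q, 'u, 's, 'z) transducer_scheme \<Rightarrow> bool" where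
  "fiber_linear S T \<longleftrightarrow>
     (\<exists>t p. \<forall>i\<in>S. is_simple_path (hold_graph T i) (t i) (p i) \<and>
        (\<forall>u\<in>tinputs T. \<forall>j\<in>S. tvis T (tstep T (p i) u) = j \<longrightarrow> tstep T (p i) u = t j))"


definition phase_expanded ::
    "('s, 'a, 'u, 'z) dlsl_scheme \<Rightarrow> ('s \<times> nat, 'u, 's) transducer" where
  "phase_expanded A =
     \<lparr> tstates = {(i, r). i \<in> vstates A \<and> r \<le> dwell A i - 1},
       tinit = (vinit A, dwell A (vinit A) - 1),
       tinputs = inputs A,
       toutputs = vstates A,
       tstep = (\<lambda>(i, r) u. if r > 0 then (i, r - 1)
                 else (let j = label_succ A i (guard A i u) in (j, dwell A j - 1))),
       tvis = fst \<rparr>"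


text \<open>If the guard of a visible state \<open>i\<close> selects the self-loop on every input, then \<open>(i, 0)\<close> is
  itself forced-hold and the hold graph of \<open>i\<close> is a directed cycle. Fiber-linearity of the
  phase-expanded realization therefore forces every visible state to be left on some input.\<close>

lemma simple_path_terminal:
  assumes "is_simple_path G s t"
  shows "t \<in> pverts G" and "(t, v) \<notin> parcs G"
proof -
  obtain es where es: "pre_digraph.apath (with_proj G) s es t"
      "set (pawalk_verts s es) = pverts G" "set es = parcs G"
    using assms unfolding is_simple_path_def awalk_verts_with_proj_eq by blast
  have c: "pcas s es t" "distinct (pawalk_verts s es)"
    using es(1) by (auto simp: pre_digraph.apath_def pre_digraph.awalk_def
        cas_with_proj_eq awalk_verts_with_proj_eq)
  have in_verts: "pcas x ys t \<Longrightarrow> t \<in> set (pawalk_verts x ys)" for x ys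
    by (induction ys arbitrary: x) auto
  have no_arc: "pcas x ys t \<Longrightarrow> distinct (pawalk_verts x ys) \<Longrightarrow> (t, v) \<notin> set ys" for x ys
    by (induction ys arbitrary: x) (auto dest: in_verts)
  show "t \<in> pverts G" using in_verts c es by metis
  show "(t, v) \<notin> parcs G" using no_arc c es by metis
qed

lemma fiber_linear_imp_leaves:
  assumes "fiber_linear (vstates A) (phase_expanded A)" and "i \<in> vstates A"
  shows "\<exists>u\<in>inputs A. label_succ A i (guard A i u) \<noteq> i"
proof (rule ccontr)
  assume "\<not> ?thesis"
  then have stay: "\<And>u. u \<in> inputs A \<Longrightarrow> label_succ A i (guard A i u) = i" by blast
  let ?T = "phase_expanded A"
  obtain s t where path: "is_simple_path (hold_graph ?T i) s t"
    using assms unfolding fiber_linear_def by blast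
  have t: "t \<in> Fib ?T i"
    using simple_path_terminal(1)[OF path] by (simp add: hold_graph_def)
  obtain r where r: "t = (i, r)" "r \<le> dwell A i - 1"
    using t by (cases t) (auto simp: Fib_def phase_expanded_def)
  have "hold_target ?T t (if r > 0 then (i, r - 1) else (i, dwell A i - 1))"
    using r assms(2) stay by (auto simp: hold_target_def phase_expanded_def)
  then have "forced_hold ?T t" unfolding forced_hold_def by blast
  with t have "(t, hsucc ?T t) \<in> parcs (hold_graph ?T i)"
    by (cases t) (auto simp: hold_graph_def)
  with simple_path_terminal(2)[OF path] show False by blast
qed

end

theory Submission
  imports Defs
begin

text \<open>Within the fiber of \<open>i\<close> the phase is a counter. A state
  \<open>(i, Suc k)\<close> ignores the input and moves to \<open>(i, k)\<close>, so it is
  forced-hold; \<open>(i, 0)\<close> consults the guard, and since some input leads out of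
  \<open>i\<close>, it is a decision state. Hence the hold graph is the descending chain from
  \<open>(i, dwell A i - 1)\<close> to \<open>(i, 0)\<close>
  (\<open>hold_graph_phase_expanded\<close>,
  \<open>is_simple_path_hold_graph_phase_expanded\<close>). A decision that selects \<open>j\<close>
  loads the full counter \<open>dwell A j - 1\<close>, the top of the chain of \<open>j\<close>;
  this is reset-on-decision. That steps follow edges rests on \<open>label_succ\<close>.\<close>

context dlsl_system
begin

text \<open>Membership in \<open>out_labels\<close> gives existence and label determinism gives
  uniqueness, so the definite description in \<open>label_succ\<close> denotes. Determinism speaks
  only of letters in \<open>labels A\<close>, hence the detour through
  \<open>j \<in> vstates A\<close>.\<close>

lemma label_succ:
  assumes i: "i \<in> vstates A" and a: "a \<in> out_labels A i"
  shows "label_succ A i a \<in> Out (vedges A) i" and "lab A (label_succ A i a) = a"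
proof -
  obtain j where j: "j \<in> Out (vedges A) i" "lab A j = a"
    using a by (auto simp: out_labels_def)
  then have "j \<in> vstates A" using vedges_subset by (auto simp: Out_def)
  then have "a \<in> labels A" using lab_in_labels j(2) by blast
  then have "k = j" if "k \<in> Out (vedges A) i \<and> lab A k = a" for k
    using label_det i j that unfolding label_deterministic_def by blast
  with j have "label_succ A i a \<in> Out (vedges A) i \<and> lab A (label_succ A i a) = a"
    unfolding label_succ_def by (metis (mono_tags, lifting) theI)
  then show "label_succ A i a \<in> Out (vedges A) i" "lab A (label_succ A i a) = a" by auto
qed

lemma label_succ_in_vstates:
  assumes "i \<in> vstates A" "a \<in> out_labels A i"
  shows "label_succ A i a \<in> vstates A"
  using label_succ(1)[OF assms] vedges_subset by (auto simp: Out_def)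

lemma graph_respecting_phase_expanded:
  "graph_respecting_transducer (vstates A) (vedges A) (phase_expanded A)"
proof
  let ?T = "phase_expanded A"
  have "tstates ?T = (SIGMA i:vstates A. {..dwell A i - 1})"
    by (auto simp: phase_expanded_def)
  then show "finite (tstates ?T)" using finite_vstates by simp
  show "tinit ?T \<in> tstates ?T" using vinit_in by (simp add: phase_expanded_def)
  show "finite (tinputs ?T)" using finite_inputs by (simp add: phase_expanded_def)
  show "toutputs ?T = vstates A" by (simp add: phase_expanded_def)
  show "tvis ?T ` tstates ?T = vstates A" by (force simp: phase_expanded_def)
  fix q u assume q: "q \<in> tstates ?T" and u: "u \<in> tinputs ?T"
  obtain i r where [simp]: "q = (i, r)" by (cases q)
  have i: "i \<in> vstates A" and r: "r \<le> dwell A i - 1" and g: "guard A i u \<in> out_labels A i"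
    using q u guard_in by (auto simp: phase_expanded_def)
  show "tstep ?T q u \<in> tstates ?T"
    using i r label_succ_in_vstates[OF i g] by (auto simp: phase_expanded_def Let_def)
  \<comment> \<open>A countdown step stays over \<open>i\<close> and uses the self-loop; a step from
    phase 0 uses the edge chosen by \<open>label_succ\<close>.\<close>
  show "tvis ?T (tstep ?T q u) \<in> Out (vedges A) (tvis ?T q)"
    using i self_loops label_succ(1)[OF i g]
    by (auto simp: phase_expanded_def Let_def self_looping_def Out_def)
qed

end

text \<open>Some input must exist: otherwise the condition on steps is vacuous and every state of
  the fiber is a hold target, so \<open>hsucc\<close> is not determined.\<close>

lemma hold_target_phase_expanded_Suc:
  assumes "i \<in> vstates A" "Suc r \<le> dwell A i - 1" "inputs A \<noteq> {}"
  shows "hold_target (phase_expanded A) (i, Suc r) q \<longleftrightarrow> q = (i, r)"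
  using assms by (auto simp: hold_target_def phase_expanded_def)

text \<open>On \<open>u\<close> the step leaves the fiber of \<open>i\<close>, whereas a hold target
  has to lie in it.\<close>

lemma not_forced_hold_phase_expanded_0:
  assumes "u \<in> inputs A" "label_succ A i (guard A i u) \<noteq> i"
  shows "\<not> forced_hold (phase_expanded A) (i, 0)"
  using assms by (auto simp: forced_hold_def hold_target_def phase_expanded_def Let_def)

text \<open>The arcs in the order in which the hold path from \<open>(i, n)\<close> traverses them.
  For \<open>n = 0\<close>, that is dwell 1, the list is empty and the walk is the single vertex
  \<open>(i, 0)\<close>.\<close>

definition countdown :: "'s \<Rightarrow> nat \<Rightarrow> (('s \<times> nat) \<times> ('s \<times> nat)) list" where
  "countdown i n = map (\<lambda>k. ((i, Suc k), (i, k))) (rev [0..<n])"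

lemma pcas_countdown: "pcas (i, n) (countdown i n) (i, 0)"
  by (induction n) (auto simp: countdown_def)

lemma pawalk_verts_countdown:
  "pawalk_verts (i, n) (countdown i n) = map (Pair i) (rev [0..<Suc n])"
  by (induction n) (auto simp: countdown_def)

lemma set_countdown: "set (countdown i n) = {((i, Suc k), (i, k)) | k. k < n}"
  by (auto simp: countdown_def)

lemma hold_graph_phase_expanded:
  assumes i: "i \<in> vstates A"
    and leaves: "\<exists>u\<in>inputs A. label_succ A i (guard A i u) \<noteq> i"
  shows "pverts (hold_graph (phase_expanded A) i) = Pair i ` {..dwell A i - 1}"
    and "parcs (hold_graph (phase_expanded A) i) = set (countdown i (dwell A i - 1))"
proof -
  let ?T = "phase_expanded A" and ?n = "dwell A i - 1"
  have Fib: "Fib ?T i = Pair i ` {..?n}"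
    using i by (auto simp: Fib_def phase_expanded_def)
  then show "pverts (hold_graph ?T i) = Pair i ` {..?n}" by (simp add: hold_graph_def)
  have "\<not> forced_hold ?T (i, 0)"
    using leaves not_forced_hold_phase_expanded_0 by metis
  moreover have "forced_hold ?T (i, Suc k) \<and> hsucc ?T (i, Suc k) = (i, k)" if "k < ?n" for k
  proof -
    have "hold_target ?T (i, Suc k) q \<longleftrightarrow> q = (i, k)" for q
      using that leaves by (intro hold_target_phase_expanded_Suc i) auto
    then show ?thesis by (simp add: forced_hold_def hsucc_def)
  qed
  \<comment> \<open>Split on the phase of \<open>q\<close>: phase 0 emits no arc, and phase
    \<open>Suc k\<close> emits exactly the arc to \<open>(i, k)\<close>.\<close>
  ultimately have arc: "q \<in> Fib ?T i \<and> forced_hold ?T q \<and> q' = hsucc ?T q \<longleftrightarrow>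
      (\<exists>k. q = (i, Suc k) \<and> q' = (i, k) \<and> k < ?n)" for q q'
    unfolding Fib by (cases "snd q") (auto simp: image_iff Suc_le_eq)
  have "(q, q') \<in> parcs (hold_graph ?T i) \<longleftrightarrow> (q, q') \<in> set (countdown i ?n)" for q q'
    using arc[of q q'] unfolding set_countdown hold_graph_def by simp blast
  then show "parcs (hold_graph ?T i) = set (countdown i ?n)" by auto
qed

text \<open>The walk \<open>countdown\<close> visits each phase once, and its vertices and arcs
  exhaust the hold graph.\<close>

lemma is_simple_path_hold_graph_phase_expanded:
  assumes "i \<in> vstates A" "\<exists>u\<in>inputs A. label_succ A i (guard A i u) \<noteq> i"
  shows "is_simple_path (hold_graph (phase_expanded A) i) (i, dwell A i - 1) (i, 0)"
proof -
  let ?n = "dwell A i - 1"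
  have "set (pawalk_verts (i, ?n) (countdown i ?n)) = Pair i ` {..?n}"
    unfolding pawalk_verts_countdown by (auto simp: image_iff)
  moreover have "distinct (pawalk_verts (i, ?n) (countdown i ?n))"
    unfolding pawalk_verts_countdown distinct_map by (simp add: inj_on_def)
  ultimately show ?thesis
    unfolding is_simple_path_def pre_digraph.apath_def pre_digraph.awalk_def
    using pcas_countdown hold_graph_phase_expanded[OF assms]
    by (intro exI[of _ "countdown i ?n"])
      (simp add: cas_with_proj_eq awalk_verts_with_proj_eq)
qed

theorem theorem5p5:
  fixes A :: "('s, 'a, 'u) dlsl"
  assumes "dlsl_system A"
    and leaves: "\<forall>i\<in>vstates A. \<exists>u\<in>inputs A. label_succ A i (guard A i u) \<noteq> i"
  shows "graph_respecting_transducer (vstates A) (vedges A) (phase_expanded A) \<and>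
         fiber_linear (vstates A) (phase_expanded A)"
proof
  show "graph_respecting_transducer (vstates A) (vedges A) (phase_expanded A)"
    using assms(1) by (rule dlsl_system.graph_respecting_phase_expanded)
  \<comment> \<open>At phase 0 the new counter depends only on the selected \<open>j\<close>,
    whatever the input.\<close>
  have reset: "tstep (phase_expanded A) (i, 0) u = (j, dwell A j - 1)"
    if "tvis (phase_expanded A) (tstep (phase_expanded A) (i, 0) u) = j" for i u j
    using that by (auto simp: phase_expanded_def Let_def)
  show "fiber_linear (vstates A) (phase_expanded A)"
    unfolding fiber_linear_def
  proof (rule exI[of _ "\<lambda>i. (i, dwell A i - 1)"], rule exI[of _ "\<lambda>i. (i, 0)"],
      intro ballI conjI impI)
    fix i assume "i \<in> vstates A"
    then show "is_simple_path (hold_graph (phase_expanded A) i) (i, dwell A i - 1) (i, 0)"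
      using leaves by (simp only: is_simple_path_hold_graph_phase_expanded)
  qed (rule reset)
qed

end
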